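(* Let $t\ge 1$ and $m\ge 1$ be integers, let $n=2m$, $k=2t$, and suppose that $n>10k^7$. Then $$m_{\mathrm{ev}}(2m,2t)=\binom{m}{t}.$$ Moreover, equality is attained only by an atomic construction: if $\mathcal F\subseteq\binom{[n]}{2t}$ is a $2t$-uniform eventown with $|\mathcal F|=\binom{m}{t}$, then $\mathcal F$ is a $2t$-uniform atomic eventown.
   Context: Write $[n]=\{1,\dots,n\}$ and let $\binom{[n]}{r}$ be the set of all $r$-element subsets of $[n]$. A family $\mathcal F\subseteq\binom{[n]}{2t}$ is a $2t$-uniform eventown if $|f\cap f'|$ is even for all $f,f'\in\mathcal F$. The number $m_{\mathrm{ev}}(n,2t)$ is the maximum size $|\mathcal F|$ of a $2t$-uniform eventown $\mathcal F\subseteq\binom{[n]}{2t}$. For $n=2m$, a $2t$-uniform atomic eventown (atomic construction) is a family of the following form: for some partition $[n]=p_1\sqcup\dots\sqcup p_m$ into sets $p_i$ with $|p_i|=2$ (the atoms), $$\mathcal A_t=\Big\{\bigcup_{i\in I}p_i : I\subseteq[m],\ |I|=t\Big\}.$$ *)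

theory Defs
  imports "HOL-Library.Disjoint_Sets" "HOL-Library.Ramsey"
begin

definition uniform_eventown :: "nat \<Rightarrow> nat \<Rightarrow> nat set set \<Rightarrow> bool" where
  "uniform_eventown n k F \<longleftrightarrow>
     F \<subseteq> nsets {1..n} k \<and> (\<forall>f\<in>F. \<forall>f'\<in>F. even (card (f \<inter> f')))"

(* The empty family is an eventown and all these families lie in a finite power set,
   so the maximum is over a finite nonempty set of natural numbers. *)
definition m_ev :: "nat \<Rightarrow> nat \<Rightarrow> nat" where
  "m_ev n k = Max {card F | F. uniform_eventown n k F}"

definition atom_partition :: "nat \<Rightarrow> (nat \<Rightarrow> nat set) \<Rightarrow> bool" where
  "atom_partition m p \<longleftrightarrow>
     (\<forall>i\<in>{1..m}. card (p i) = 2) \<and> disjoint_family_on p {1..m} \<and>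
     (\<Union>i\<in>{1..m}. p i) = {1..2 * m}"

definition atomic_eventown :: "nat \<Rightarrow> nat \<Rightarrow> nat set set \<Rightarrow> bool" where
  "atomic_eventown m t F \<longleftrightarrow>
     (\<exists>p. atom_partition m p \<and> F = {\<Union>i\<in>I. p i | I. I \<subseteq> {1..m} \<and> card I = t})"

end

theory Submission
  imports Defs
begin

text \<open>
  Call two points twins if they lie in the same members of the eventown \<open>F\<close>. In an atomic eventown
  with \<open>0 < t < m\<close> the twin classes are the atoms. In general, let the atoms of \<open>F\<close> be its twin classes of size
  two, \<open>s\<close> of them, covering a set \<open>U\<close> of \<open>2 s\<close> points.

  Members inside \<open>U\<close> are unions of \<open>t\<close> atoms, so there are at most \<open>s choose t\<close> of them. A point
  outside \<open>U\<close> lies in few members. The tool is parity: if \<open>S\<close> meets some member \<open>g\<close> in an odd number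
  of points, then each member containing \<open>S\<close> must meet \<open>g\<close> outside \<open>S\<close>, so one of at most \<open>k = 2 t\<close>
  points of \<open>g\<close> can be added to \<open>S\<close> (\<open>degree_le_of_odd_trace\<close>). A member through a point
  with at least two twins contains a fixed triple. A point \<open>x\<close> without twins can be
  extended to a pair \<open>{x, y}\<close> in \<open>k\<close> ways, and then, since some member separates \<open>x\<close> from \<open>y\<close>, to a
  triple in \<open>k\<close> ways. So its degree is at most \<open>k\<^sup>2\<close> times the largest degree \<open>D\<close> of a triple. A
  triple again extends to a quadruple in \<open>k\<close> ways, and the members through a quadruple form, after
  its removal, an eventown with \<open>t - 2\<close> in place of \<open>t\<close>. By induction on \<open>t\<close> this gives
  \<open>D \<le> k (m choose (t - 2))\<close> for \<open>t \<ge> 2\<close>, which for fixed \<open>t\<close> is smaller than \<open>m choose t\<close> by a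
  factor of order \<open>m\<^sup>2\<close>.

  Hence \<open>card F \<le> (s choose t) + 2 (m - s) k\<^sup>2 D\<close>. As \<open>s choose t\<close> is convex in \<open>s\<close>, replacing
  \<open>m\<close> by \<open>s\<close> in \<open>m choose t\<close> loses at least the proportion \<open>(m - s) / m\<close>, which exceeds the second
  term unless \<open>s = m\<close>. For \<open>s = m\<close> the atoms cover everything, and \<open>F\<close> is contained in the atomic
  eventown that they define.
\<close>

section \<open>Degrees in an eventown\<close>

definition degree :: "'a set set \<Rightarrow> 'a set \<Rightarrow> nat" where
  "degree F S = card {f \<in> F. S \<subseteq> f}"

lemma degree_le_of_transversal:
  assumes "finite F" "finite A"
    and meets: "\<And>f. f \<in> F \<Longrightarrow> S \<subseteq> f \<Longrightarrow> f \<inter> A \<noteq> {}"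
    and bound: "\<And>y. y \<in> A \<Longrightarrow> degree F (insert y S) \<le> b"
  shows "degree F S \<le> card A * b"
proof -
  have "{f \<in> F. S \<subseteq> f} \<subseteq> (\<Union>y\<in>A. {f \<in> F. insert y S \<subseteq> f})"
  proof
    fix f assume "f \<in> {f \<in> F. S \<subseteq> f}"
    moreover from this obtain y where "y \<in> f \<inter> A" using meets by blast
    ultimately show "f \<in> (\<Union>y\<in>A. {f \<in> F. insert y S \<subseteq> f})" by blast
  qed
  hence "degree F S \<le> card (\<Union>y\<in>A. {f \<in> F. insert y S \<subseteq> f})"
    unfolding degree_def using assms(1,2) by (intro card_mono) auto
  also have "\<dots> \<le> (\<Sum>y\<in>A. degree F (insert y S))"
    unfolding degree_def by (rule card_UN_le[OF assms(2)])
  also have "\<dots> \<le> card A * b"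
    using sum_bounded_above[of A "\<lambda>y. degree F (insert y S)" b, OF bound] by simp
  finally show ?thesis .
qed

lemma uniform_eventown_finite:
  assumes "uniform_eventown n k F"
  shows "finite F"
  using assms unfolding uniform_eventown_def
  by (meson finite_atLeastAtMost finite_imp_finite_nsets finite_subset)

lemma uniform_eventown_member:
  assumes "uniform_eventown n k F" "f \<in> F"
  shows "f \<subseteq> {1..n}" "finite f" "card f = k"
  using assms unfolding uniform_eventown_def nsets_def by auto

text \<open>A member through \<open>S\<close> shares with \<open>g\<close> the odd number of points of \<open>S \<inter> g\<close>, hence also a point
  outside \<open>S\<close>.\<close>

lemma degree_le_of_odd_trace:
  assumes ev: "uniform_eventown n k F" and "g \<in> F" and odd: "odd (card (S \<inter> g))"
    and bound: "\<And>y. y \<in> g - S \<Longrightarrow> degree F (insert y S) \<le> b"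
  shows "degree F S \<le> k * b"
proof -
  note g = uniform_eventown_member[OF ev \<open>g \<in> F\<close>]
  have "degree F S \<le> card (g - S) * b"
  proof (rule degree_le_of_transversal)
    fix f assume f: "f \<in> F" "S \<subseteq> f"
    have "even (card (f \<inter> g))"
      using ev f(1) \<open>g \<in> F\<close> unfolding uniform_eventown_def by blast
    hence "f \<inter> g \<noteq> S \<inter> g" using odd by metis
    thus "f \<inter> (g - S) \<noteq> {}" using f(2) by blast
  qed (use uniform_eventown_finite[OF ev] g bound in auto)
  also have "card (g - S) \<le> k" using g by (metis Diff_subset card_mono)
  finally show ?thesis by simp
qed

lemma degree_le_of_odd_card:
  assumes ev: "uniform_eventown n k F" and odd: "odd (card S)"
    and bound: "\<And>y. y \<notin> S \<Longrightarrow> degree F (insert y S) \<le> b"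
  shows "degree F S \<le> k * b"
proof (cases "\<exists>g\<in>F. S \<subseteq> g")
  case True
  then obtain g where "g \<in> F" "S \<subseteq> g" by blast
  moreover from this have "S \<inter> g = S" by blast
  ultimately show ?thesis
    using degree_le_of_odd_trace[OF ev, of g S b] odd bound by simp
next
  case False
  hence no_member: "{f \<in> F. S \<subseteq> f} = {}" by blast
  show ?thesis unfolding degree_def no_member by simp
qed

text \<open>Removing an even set common to two members preserves the parity of their intersection, so
  the members through such a set form a smaller eventown.\<close>

lemma degree_le_of_link_bound:
  assumes ev: "uniform_eventown n k F" and S: "finite S" "even (card S)"
    and bound: "\<And>G. uniform_eventown n (k - card S) G \<Longrightarrow> card G \<le> b"
  shows "degree F S \<le> b"
proof -
  let ?L = "{f \<in> F. S \<subseteq> f}"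
  let ?G = "(\<lambda>f. f - S) ` ?L"
  have "inj_on (\<lambda>f. f - S) ?L" by (rule inj_onI) blast
  hence card: "card ?G = degree F S" unfolding degree_def by (rule card_image)
  have "uniform_eventown n (k - card S) ?G"
    unfolding uniform_eventown_def
  proof (intro conjI ballI subsetI)
    fix g assume "g \<in> ?G"
    then obtain f where f: "f \<in> F" "S \<subseteq> f" "g = f - S" by blast
    show "g \<in> nsets {1..n} (k - card S)"
      using uniform_eventown_member[OF ev f(1)] f S by (auto simp: nsets_def card_Diff_subset)
  next
    fix g g' assume "g \<in> ?G" "g' \<in> ?G"
    then obtain f f' where f: "f \<in> F" "S \<subseteq> f" "g = f - S" "f' \<in> F" "S \<subseteq> f'" "g' = f' - S"
      by blast
    have "g \<inter> g' = (f \<inter> f') - S" using f by blast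
    hence "card (g \<inter> g') = card (f \<inter> f') - card S"
      using f S by (simp add: card_Diff_subset)
    moreover have "even (card (f \<inter> f'))" using ev f unfolding uniform_eventown_def by blast
    ultimately show "even (card (g \<inter> g'))" using S by simp
  qed
  from bound[OF this] card show ?thesis by simp
qed

section \<open>Twins and atoms\<close>

definition twins :: "'a set set \<Rightarrow> 'a \<Rightarrow> 'a \<Rightarrow> bool" where
  "twins F x y \<longleftrightarrow> (\<forall>f\<in>F. x \<in> f \<longleftrightarrow> y \<in> f)"

definition twin_class :: "'a set \<Rightarrow> 'a set set \<Rightarrow> 'a \<Rightarrow> 'a set" where
  "twin_class X F x = {y \<in> X. twins F x y}"

definition atoms :: "'a set \<Rightarrow> 'a set set \<Rightarrow> 'a set set" where
  "atoms X F = {twin_class X F x | x. x \<in> X \<and> card (twin_class X F x) = 2}"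

lemma twin_class_eq: "twins F x y \<Longrightarrow> twin_class X F x = twin_class X F y"
  unfolding twin_class_def twins_def by auto

lemma atoms_disjoint: "disjoint (atoms X F)"
proof (rule disjointI)
  fix p q assume pq: "p \<in> atoms X F" "q \<in> atoms X F" "p \<noteq> q"
  then obtain x y where xy: "p = twin_class X F x" "q = twin_class X F y"
    unfolding atoms_def by blast
  show "p \<inter> q = {}"
  proof (rule ccontr)
    assume "p \<inter> q \<noteq> {}"
    then obtain z where "twins F x z" "twins F y z" using xy by (auto simp: twin_class_def)
    thus False using pq(3) xy by (metis twin_class_eq)
  qed
qed

lemma atoms_card2: "p \<in> atoms X F \<Longrightarrow> card p = 2"
  unfolding atoms_def by auto

lemma atoms_subset: "\<Union>(atoms X F) \<subseteq> X"
  unfolding atoms_def twin_class_def by auto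

lemma finite_atoms: "finite X \<Longrightarrow> finite (atoms X F)"
  unfolding atoms_def by simp

lemma atom_subset_member:
  assumes "p \<in> atoms X F" "f \<in> F" "x \<in> p" "x \<in> f"
  shows "p \<subseteq> f"
  using assms unfolding atoms_def twin_class_def twins_def by auto

lemma card_Union_pairs:
  assumes "disjoint P" "\<And>p. p \<in> P \<Longrightarrow> card p = 2"
  shows "card (\<Union>P) = 2 * card P"
proof -
  have "card (\<Union>P) = sum card P"
    using assms by (intro card_Union_disjoint) (auto simp: disjoint_def pairwise_def disjnt_def
        intro!: card_ge_0_finite)
  also have "\<dots> = 2 * card P" using assms(2) by simp
  finally show ?thesis .
qed

lemma members_covered_by_atoms:
  assumes "finite X"
  shows "{f \<in> F. card f = 2 * t \<and> f \<subseteq> \<Union>(atoms X F)} \<subseteq> Union ` nsets (atoms X F) t"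
proof
  fix f assume f: "f \<in> {f \<in> F. card f = 2 * t \<and> f \<subseteq> \<Union>(atoms X F)}"
  let ?Q = "{p \<in> atoms X F. p \<subseteq> f}"
  have un: "\<Union>?Q = f" using f atom_subset_member by fastforce
  have "disjoint ?Q" using atoms_disjoint by (auto intro: pairwise_subset)
  hence "card f = 2 * card ?Q"
    using card_Union_pairs[of ?Q] un atoms_card2 by force
  hence "card ?Q = t" using f by simp
  hence "?Q \<in> nsets (atoms X F) t"
    using finite_atoms[OF assms] by (auto simp: nsets_def)
  thus "f \<in> Union ` nsets (atoms X F) t" using un by blast
qed

text \<open>A member separating \<open>x\<close> from \<open>y\<close> meets \<open>{x, y}\<close> in one point.\<close>

lemma degree_pair_le_of_not_twins:
  assumes ev: "uniform_eventown n k F" and xy: "\<not> twins F x y"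
    and triple: "\<And>S. card S = 3 \<Longrightarrow> degree F S \<le> D"
  shows "degree F {x, y} \<le> k * D"
proof -
  obtain g where g: "g \<in> F" "(x \<in> g) \<noteq> (y \<in> g)" using xy unfolding twins_def by blast
  hence "{x, y} \<inter> g = {x} \<or> {x, y} \<inter> g = {y}" by blast
  hence "odd (card ({x, y} \<inter> g))" by auto
  moreover have "x \<noteq> y" using g by blast
  ultimately show ?thesis
    using g(1) triple by (intro degree_le_of_odd_trace[OF ev]) auto
qed

text \<open>The two reasons for a point not to be in an atom, having two twins or having none, both
  bound its degree in terms of triples.\<close>

lemma degree_le_of_not_atom:
  assumes ev: "uniform_eventown n k F" and "k \<ge> 1"
    and x: "x \<in> {1..n}" "x \<notin> \<Union>(atoms {1..n} F)"
    and triple: "\<And>S. card S = 3 \<Longrightarrow> degree F S \<le> D"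
  shows "degree F {x} \<le> k * (k * D)"
proof -
  let ?C = "twin_class {1..n} F x"
  have fin: "finite ?C" unfolding twin_class_def by simp
  have self: "x \<in> ?C" using x unfolding twin_class_def twins_def by simp
  hence "card ?C \<noteq> 2" using x unfolding atoms_def by blast
  moreover have "card ?C \<noteq> 0" using fin self by auto
  ultimately consider "card ?C = 1" | "card ?C \<ge> 3" by linarith
  thus ?thesis
  proof cases
    case 1
    then obtain z where "?C = {z}" by (auto simp: card_1_singleton_iff)
    with self have C: "?C = {x}" by simp
    show ?thesis
    proof (cases "\<exists>g\<in>F. x \<in> g")
      case True
      then obtain g where g: "g \<in> F" "x \<in> g" by blast
      show ?thesis
      proof (rule degree_le_of_odd_trace[OF ev g(1)])
        have "{x} \<inter> g = {x}" using g by blast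
        thus "odd (card ({x} \<inter> g))" by simp
        fix y assume y: "y \<in> g - {x}"
        hence "y \<in> {1..n}" using uniform_eventown_member[OF ev g(1)] by blast
        hence "\<not> twins F y x" using C y unfolding twin_class_def twins_def by blast
        from degree_pair_le_of_not_twins[OF ev this triple]
        show "degree F {y, x} \<le> k * D" .
      qed
    next
      case False
      hence no_member: "{f \<in> F. {x} \<subseteq> f} = {}" by blast
      show ?thesis unfolding degree_def no_member by simp
    qed
  next
    case 2
    obtain S where S: "S \<subseteq> ?C" "card S = 3" by (rule obtain_subset_with_card_n[OF 2])
    have "{f \<in> F. {x} \<subseteq> f} \<subseteq> {f \<in> F. S \<subseteq> f}"
      using S(1) unfolding twin_class_def twins_def by blast
    hence "degree F {x} \<le> degree F S"
      unfolding degree_def using uniform_eventown_finite[OF ev] by (intro card_mono) auto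
    also have "\<dots> \<le> D" by (rule triple[OF S(2)])
    also have "\<dots> \<le> k * (k * D)" using \<open>k \<ge> 1\<close> by simp
    finally show ?thesis .
  qed
qed

section \<open>Counting the members\<close>

lemma card_members_leaving_le:
  assumes "finite F" "finite X" "\<And>f. f \<in> F \<Longrightarrow> f \<subseteq> X"
    and bound: "\<And>x. x \<in> X - U \<Longrightarrow> degree F {x} \<le> b"
  shows "card {f \<in> F. \<not> f \<subseteq> U} \<le> card (X - U) * b"
proof -
  let ?G = "{f \<in> F. \<not> f \<subseteq> U}"
  have "degree ?G {} \<le> card (X - U) * b"
  proof (rule degree_le_of_transversal)
    fix y assume "y \<in> X - U"
    moreover have "degree ?G {y} \<le> degree F {y}"
      unfolding degree_def using assms(1) by (intro card_mono) auto
    ultimately show "degree ?G {y} \<le> b" using bound le_trans by blast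
  qed (use assms in auto)
  thus ?thesis unfolding degree_def by simp
qed

text \<open>This is convexity of \<open>s choose t\<close> in \<open>s\<close>, for the chord from \<open>0\<close> to \<open>m\<close>. It holds because the
  slope \<open>(s choose t) / s\<close> equals \<open>((s - 1) choose (t - 1)) / t\<close>, which grows with \<open>s\<close>.\<close>

lemma binomial_below_chord:
  assumes "s \<le> m" "t \<ge> 1"
  shows "m * (s choose t) \<le> s * (m choose t)"
proof -
  have absorb: "t * (j choose t) = j * ((j - 1) choose (t - 1))" for j
    using times_binomial_minus1_eq[of t j] assms(2) by simp
  have "t * (m * (s choose t)) = m * (s * ((s - 1) choose (t - 1)))"
    using absorb[of s] by (metis mult.left_commute)
  also have "\<dots> \<le> m * (s * ((m - 1) choose (t - 1)))"
    using assms(1) by (intro mult_left_mono binomial_right_mono) auto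
  also have "\<dots> = t * (s * (m choose t))"
    using absorb[of m] by (metis mult.left_commute)
  finally show ?thesis using assms(2) by simp
qed

lemma atomic_eventown_of_pairs:
  assumes P: "disjoint P" "\<And>p. p \<in> P \<Longrightarrow> card p = 2" "finite P" "card P = m"
    and cover: "\<Union>P = {1..2 * m}" and F: "F = Union ` nsets P t"
  shows "atomic_eventown m t F"
proof -
  obtain p where p: "bij_betw p {1..m} P"
    using P(3,4) by (metis card_atLeastAtMost diff_Suc_1 finite_atLeastAtMost finite_same_card_bij)
  hence img: "p ` {1..m} = P" and inj: "inj_on p {1..m}" by (auto simp: bij_betw_def)
  have "atom_partition m p"
    unfolding atom_partition_def
  proof (intro conjI)
    show "\<forall>i\<in>{1..m}. card (p i) = 2" using P(2) img by blast
    show "disjoint_family_on p {1..m}"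
      unfolding disjoint_family_on_def
    proof (intro ballI impI)
      fix i j assume ij: "i \<in> {1..m}" "j \<in> {1..m}" "i \<noteq> j"
      hence "p i \<noteq> p j" using inj by (auto dest: inj_onD)
      moreover have "p i \<in> P" "p j \<in> P" using ij img by auto
      ultimately show "p i \<inter> p j = {}" using P(1) by (auto simp: disjoint_def)
    qed
    show "(\<Union>i\<in>{1..m}. p i) = {1..2 * m}" using cover img by simp
  qed
  moreover have "F = {\<Union>i\<in>I. p i | I. I \<subseteq> {1..m} \<and> card I = t}"
  proof -
    have "nsets P t = (\<lambda>I. p ` I) ` {I. I \<subseteq> {1..m} \<and> card I = t}"
    proof (intro equalityI subsetI)
      fix Q assume Q: "Q \<in> nsets P t"
      then obtain I where I: "I \<subseteq> {1..m}" "Q = p ` I"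
        using img unfolding nsets_def by (auto simp: subset_image_iff)
      hence "card I = t"
        using Q inj_on_subset[OF inj] by (auto simp: nsets_def card_image)
      thus "Q \<in> (\<lambda>I. p ` I) ` {I. I \<subseteq> {1..m} \<and> card I = t}" using I by blast
    next
      fix Q assume "Q \<in> (\<lambda>I. p ` I) ` {I. I \<subseteq> {1..m} \<and> card I = t}"
      then obtain I where I: "I \<subseteq> {1..m}" "card I = t" "Q = p ` I" by blast
      hence "card Q = t" using inj_on_subset[OF inj] by (auto simp: card_image)
      moreover have "finite Q" using I(1,3) finite_subset by blast
      moreover have "Q \<subseteq> P" using I img by blast
      ultimately show "Q \<in> nsets P t" unfolding nsets_def by simp
    qed
    thus ?thesis unfolding F by (auto simp: image_image)
  qed
  ultimately show ?thesis unfolding atomic_eventown_def by blast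
qed

text \<open>All estimates are relative to the maximal degree \<open>D\<close> of a triple: once \<open>D\<close> is small
  compared to \<open>m choose t\<close>, only eventowns whose atoms cover the ground set can be extremal.\<close>

lemma eventown_bound_of_triple_degree:
  assumes ev: "uniform_eventown (2 * m) (2 * t) F" and "t \<ge> 1"
    and triple: "\<And>S. card S = 3 \<Longrightarrow> degree F S \<le> D"
    and small: "2 * m * (2 * t * (2 * t * D)) < m choose t"
  shows "card F \<le> m choose t \<and> (card F = m choose t \<longrightarrow> atomic_eventown m t F)"
proof -
  let ?X = "{1..2 * m}"
  let ?P = "atoms ?X F"
  let ?U = "\<Union>?P"
  let ?b = "2 * t * (2 * t * D)"
  define s where "s = card ?P"
  have finP: "finite ?P" by (rule finite_atoms) simp
  have finF: "finite F" by (rule uniform_eventown_finite[OF ev])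
  have cardU: "card ?U = 2 * s"
    unfolding s_def by (rule card_Union_pairs[OF atoms_disjoint atoms_card2])
  have UX: "?U \<subseteq> ?X" by (rule atoms_subset)
  have sm: "s \<le> m" using card_mono[OF _ UX] cardU by simp
  have inside: "{f \<in> F. f \<subseteq> ?U} \<subseteq> Union ` nsets ?P t"
    using members_covered_by_atoms[of ?X F t] uniform_eventown_member(3)[OF ev] by auto
  have fin_unions: "finite (Union ` nsets ?P t)"
    using finP by (simp add: finite_imp_finite_nsets)
  have card_unions: "card (Union ` nsets ?P t) \<le> s choose t"
    using card_image_le[of "nsets ?P t" Union] finP
    by (simp add: finite_imp_finite_nsets s_def)
  show ?thesis
  proof (cases "s = m")
    case True
    have UX_eq: "?U = ?X" using card_subset_eq[OF _ UX] cardU True by simp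
    have sub: "F \<subseteq> Union ` nsets ?P t"
      using inside uniform_eventown_member(1)[OF ev] unfolding UX_eq by blast
    have le: "card F \<le> m choose t"
      using card_mono[OF fin_unions sub] card_unions True by simp
    have "atomic_eventown m t F" if "card F = m choose t"
    proof (rule atomic_eventown_of_pairs[OF atoms_disjoint atoms_card2 finP])
      show "card ?P = m" using True s_def by simp
      show "?U = ?X" by (rule UX_eq)
      have "card (Union ` nsets ?P t) \<le> card F" using that card_unions True by simp
      thus "F = Union ` nsets ?P t" by (rule card_seteq[OF fin_unions sub])
    qed
    with le show ?thesis by blast
  next
    case neq: False
    have lt: "s < m" using sm neq by simp
    have "card {f \<in> F. \<not> f \<subseteq> ?U} \<le> card (?X - ?U) * ?b"
    proof (rule card_members_leaving_le[OF finF])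
      fix x assume "x \<in> ?X - ?U"
      thus "degree F {x} \<le> ?b"
        using degree_le_of_not_atom[OF ev _ _ _ triple] \<open>t \<ge> 1\<close> by simp
    qed (use uniform_eventown_member(1)[OF ev] in auto)
    moreover have "card (?X - ?U) = 2 * (m - s)"
      using UX cardU finite_subset[OF UX] by (simp add: card_Diff_subset)
    moreover have "card {f \<in> F. f \<subseteq> ?U} \<le> s choose t"
      using card_mono[OF fin_unions inside] card_unions by simp
    moreover have "card F = card {f \<in> F. f \<subseteq> ?U} + card {f \<in> F. \<not> f \<subseteq> ?U}"
    proof -
      have "F = {f \<in> F. f \<subseteq> ?U} \<union> {f \<in> F. \<not> f \<subseteq> ?U}" by blast
      thus ?thesis using finF by (subst \<open>F = _\<close>, subst card_Un_disjoint) auto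
    qed
    ultimately have "card F \<le> (s choose t) + 2 * (m - s) * ?b" by simp
    hence "m * card F \<le> m * ((s choose t) + 2 * (m - s) * ?b)" by (rule mult_le_mono2)
    also have "\<dots> = m * (s choose t) + (m - s) * (2 * m * ?b)"
      by (simp add: algebra_simps)
    also have "\<dots> < s * (m choose t) + (m - s) * (m choose t)"
      using binomial_below_chord[OF sm \<open>t \<ge> 1\<close>] small lt by (intro add_le_less_mono mult_strict_left_mono) auto
    also have "\<dots> = m * (m choose t)"
      using sm by (simp flip: add_mult_distrib)
    finally have "card F < m choose t" by simp
    thus ?thesis by simp
  qed
qed

text \<open>Two applications of the absorption identity express \<open>m choose t\<close> through
  \<open>m choose (t - 2)\<close>, with the factor \<open>(m - t + 1) (m - t + 2) / (t (t - 1)) \<ge> (m / 2)\<^sup>2 / t\<^sup>2\<close>.\<close>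

lemma binomial_step_two_large:
  assumes t: "t \<ge> 2" and m: "m > 64 * t ^ 5"
  shows "2 * m * (2 * t * (2 * t * (2 * t * (m choose (t - 2))))) < m choose t"
proof -
  let ?B = "m choose (t - 2)"
  have "t ^ 1 \<le> t ^ 5" using t by (intro power_increasing) auto
  hence tm: "64 * t < m" using m by simp
  have absorb: "Suc j * (m choose Suc j) = (m - j) * (m choose j)" for j
    by (metis binomial_absorb_comp binomial_absorption)
  have Bpos: "?B > 0" using tm by simp
  have e1: "t * (m choose t) = (m - (t - 1)) * (m choose (t - 1))"
    using absorb[of "t - 1"] t by simp
  have e2: "(t - 1) * (m choose (t - 1)) = (m - (t - 2)) * ?B"
    using absorb[of "t - 2"] t by (simp add: Suc_diff_le numeral_2_eq_2 Suc_diff_Suc)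
  have "t * (t - 1) * (m choose t) = (m - (t - 1)) * ((t - 1) * (m choose (t - 1)))"
    using e1 by (metis mult.commute mult.left_commute)
  also have "\<dots> = (m - (t - 1)) * (m - (t - 2)) * ?B"
    using e2 by simp
  finally have two: "t * (t - 1) * (m choose t) = (m - (t - 1)) * (m - (t - 2)) * ?B" .
  have "m * m \<le> (2 * (m - (t - 1))) * (2 * (m - (t - 2)))"
    using tm by (intro mult_mono) auto
  hence half: "m * m \<le> 4 * ((m - (t - 1)) * (m - (t - 2)))" by simp
  have "t * t * (2 * m * (2 * t * (2 * t * (2 * t * ?B)))) * 4 = m * (64 * t ^ 5) * ?B"
    by (simp add: power_numeral_reduce algebra_simps)
  also have "\<dots> < m * m * ?B"
    using m Bpos by (intro mult_strict_right_mono mult_strict_left_mono) auto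
  also have "\<dots> \<le> 4 * ((m - (t - 1)) * (m - (t - 2))) * ?B"
    using half by (rule mult_right_mono) simp
  also have "\<dots> = 4 * (t * (t - 1) * (m choose t))" using two by simp
  also have "\<dots> \<le> 4 * (t * t * (m choose t))" by simp
  finally have "t * t * (2 * m * (2 * t * (2 * t * (2 * t * ?B)))) < t * t * (m choose t)"
    by simp
  thus ?thesis by simp
qed

text \<open>The hypothesis is weaker than \<open>2 m > 10 (2 t)\<^sup>7\<close> and is inherited by \<open>t - 2\<close>, which the
  induction needs.\<close>

lemma eventown_bound:
  assumes "uniform_eventown (2 * m) (2 * t) F" "t \<ge> 1" "m > 64 * t ^ 5"
  shows "card F \<le> m choose t \<and> (card F = m choose t \<longrightarrow> atomic_eventown m t F)"
  using assms
proof (induction t arbitrary: F rule: less_induct)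
  case (less t)
  note ev = less.prems(1)
  show ?case
  proof (cases "t = 1")
    case True
    \<comment> \<open>Members are pairs, so no triple lies in one.\<close>
    have "degree F S \<le> 0" if S: "card S = 3" for S
    proof -
      have "\<not> S \<subseteq> f" if "f \<in> F" for f
        using uniform_eventown_member(2,3)[OF ev that] card_mono[of f S] S True by auto
      hence "{f \<in> F. S \<subseteq> f} = {}" by blast
      thus ?thesis unfolding degree_def by (metis card.empty le_refl)
    qed
    from eventown_bound_of_triple_degree[OF ev less.prems(2) this]
    show ?thesis using True less.prems(3) by simp
  next
    case False
    hence t2: "t \<ge> 2" using less.prems(2) by simp
    let ?B = "m choose (t - 2)"
    have link: "card G \<le> ?B" if G: "uniform_eventown (2 * m) (2 * t - 4) G" for G
    proof (cases "t = 2")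
      case True
      hence "G \<subseteq> {{}}" using uniform_eventown_member(2,3)[OF G] by fastforce
      from card_mono[OF _ this] show ?thesis using True by simp
    next
      case False
      have "2 * t - 4 = 2 * (t - 2)" by simp
      with G have G': "uniform_eventown (2 * m) (2 * (t - 2)) G" by simp
      have "(t - 2) ^ 5 \<le> t ^ 5" by (rule power_mono) auto
      hence "64 * (t - 2) ^ 5 < m" using less.prems(3) by linarith
      thus ?thesis using less.IH[OF _ G'] t2 False by simp
    qed
    have triple: "degree F S \<le> 2 * t * ?B" if S: "card S = 3" for S
    proof (rule degree_le_of_odd_card[OF ev])
      show "odd (card S)" using S by simp
      fix y assume "y \<notin> S"
      have fin: "finite S" using S by (intro card_ge_0_finite) simp
      have c4: "card (insert y S) = 4" using S fin \<open>y \<notin> S\<close> by simp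
      show "degree F (insert y S) \<le> ?B"
        using link by (intro degree_le_of_link_bound[OF ev]) (auto simp: fin c4)
    qed
    show ?thesis
      by (rule eventown_bound_of_triple_degree[OF ev less.prems(2) triple
            binomial_step_two_large[OF t2 less.prems(3)]])
  qed
qed

section \<open>The atomic construction\<close>

lemma pair_unions_eventown:
  assumes P: "disjoint P" "\<And>p. p \<in> P \<Longrightarrow> card p = 2" and X: "\<Union>P \<subseteq> {1..n}"
  shows "uniform_eventown n (2 * t) (Union ` nsets P t)"
  unfolding uniform_eventown_def
proof (intro conjI ballI subsetI)
  fix f assume "f \<in> Union ` nsets P t"
  then obtain Q where Q: "Q \<subseteq> P" "card Q = t" "f = \<Union>Q" by (auto simp: nsets_def)
  have "card f = 2 * t"
    using card_Union_pairs[of Q] P Q by (auto intro: pairwise_subset)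
  moreover have "f \<subseteq> {1..n}" using Q X by blast
  ultimately show "f \<in> nsets {1..n} (2 * t)"
    by (auto simp: nsets_def intro: finite_subset)
next
  fix f g assume "f \<in> Union ` nsets P t" "g \<in> Union ` nsets P t"
  then obtain Q R where Q: "Q \<subseteq> P" "f = \<Union>Q" and R: "R \<subseteq> P" "g = \<Union>R"
    by (auto simp: nsets_def)
  have "f \<inter> g = \<Union>(Q \<inter> R)"
  proof (intro equalityI subsetI)
    fix x assume "x \<in> f \<inter> g"
    then obtain q q' where q: "q \<in> Q" "q' \<in> R" "x \<in> q" "x \<in> q'" using Q R by blast
    hence "q = q'" using disjointD[OF P(1), of q q'] Q(1) R(1) by blast
    thus "x \<in> \<Union>(Q \<inter> R)" using q by blast
  qed (use Q R in auto)
  moreover have "disjoint (Q \<inter> R)" using P(1) Q by (auto intro: pairwise_subset)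
  ultimately show "even (card (f \<inter> g))"
    using card_Union_pairs[of "Q \<inter> R"] P(2) Q by (metis Int_iff dvd_triv_left subsetD)
qed

text \<open>A set of disjoint nonempty blocks is recovered from its union as the set of blocks inside
  it.\<close>

lemma inj_on_Union_disjoint:
  assumes "disjoint P" "{} \<notin> P"
  shows "inj_on Union (Pow P)"
proof (rule inj_onI)
  have rec: "Q = {p \<in> P. p \<noteq> {} \<and> p \<subseteq> \<Union>Q}" if "Q \<subseteq> P" for Q
  proof (intro equalityI subsetI)
    fix p assume "p \<in> Q"
    thus "p \<in> {p \<in> P. p \<noteq> {} \<and> p \<subseteq> \<Union>Q}" using that assms(2) by blast
  next
    fix p assume p: "p \<in> {p \<in> P. p \<noteq> {} \<and> p \<subseteq> \<Union>Q}"
    then obtain x q where "x \<in> p" "q \<in> Q" "x \<in> q" by blast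
    moreover from this have "p = q" using p that assms(1) unfolding disjoint_def by blast
    ultimately show "p \<in> Q" by simp
  qed
  fix Q R assume "Q \<in> Pow P" "R \<in> Pow P" "\<Union>Q = \<Union>R"
  thus "Q = R" using rec[of Q] rec[of R] by simp
qed

lemma ex_eventown_of_card_binomial:
  "\<exists>F. uniform_eventown (2 * m) (2 * t) F \<and> card F = m choose t"
proof -
  let ?P = "(\<lambda>i. {2 * i + 1, 2 * i + 2}) ` {..<m}"
  have pair: "card p = 2" if "p \<in> ?P" for p using that by auto
  have disj: "disjoint ?P"
    unfolding disjoint_def by (auto; presburger)
  have "inj_on (\<lambda>i::nat. {2 * i + 1, 2 * i + 2}) {..<m}"
    by (rule inj_onI) (auto simp: doubleton_eq_iff)
  hence cardP: "card ?P = m" by (simp add: card_image)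
  have "inj_on Union (nsets ?P t)"
    by (rule inj_on_subset[OF inj_on_Union_disjoint[OF disj]]) (auto simp: nsets_def)
  hence "card (Union ` nsets ?P t) = m choose t"
    using cardP by (simp add: card_image)
  moreover have "uniform_eventown (2 * m) (2 * t) (Union ` nsets ?P t)"
    using pair by (intro pair_unions_eventown[OF disj]) auto
  ultimately show ?thesis by blast
qed

section \<open>The extremal theorem\<close>

theorem theorem1p1:
  fixes t m n k :: nat
  assumes "t \<ge> 1" and "m \<ge> 1"
    and "n = 2 * m" and "k = 2 * t"
    and "n > 10 * k ^ 7"
  shows "m_ev (2 * m) (2 * t) = m choose t \<and>
         (\<forall>F. uniform_eventown n (2 * t) F \<and> card F = m choose t \<longrightarrow> atomic_eventown m t F)"
proof -
  have "t ^ 5 \<le> t ^ 7" using assms(1) by (intro power_increasing) auto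
  moreover have "m > 640 * t ^ 7" using assms(3-5) by (simp add: power_mult_distrib)
  ultimately have large: "m > 64 * t ^ 5" by linarith
  note bound = eventown_bound[OF _ assms(1) large]
  let ?S = "{card F | F. uniform_eventown (2 * m) (2 * t) F}"
  have "?S \<subseteq> {..m choose t}" using bound by fastforce
  moreover have "m choose t \<in> ?S" using ex_eventown_of_card_binomial[of m t] by force
  ultimately have "Max ?S = m choose t"
    by (intro Max_eqI) (auto intro: finite_subset)
  thus ?thesis using bound assms(3) unfolding m_ev_def by blast
qed

end
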